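(* Let $n,m,L,T\in\mathbb{N}$ and consider the LTV system $x(k+1)=A(k)x(k)+B(k)u(k)$ with $A(k)\in\mathbb{R}^{n\times n}$, $B(k)\in\mathbb{R}^{n\times m}$. Let $X(k)\in\mathbb{R}^{n\times L}$, $k=0,\dots,T$, and $U(k)\in\mathbb{R}^{m\times L}$, $k=0,\dots,T-1$, be the data matrices formed from an ensemble of $L$ input-state data sequences of this system (see context), and suppose that $$\mathrm{rank}\begin{bmatrix}X(k)\\ U(k)\end{bmatrix}=n+m,\qquad k=0,\dots,T-1.$$ Let $\eta\ge 1$ and $\rho>\eta$ be finite constants, and let $Y(k)\in\mathbb{R}^{L\times n}$, $k=0,\dots,T-1$, and $P(k)=P(k)^\top\in\mathbb{R}^{n\times n}$, $k=0,\dots,T$, be any sequences of matrices satisfying $$\begin{bmatrix}P(k+1)-I_n & X(k+1)Y(k)\\ Y(k)^\top X(k+1)^\top & P(k)\end{bmatrix}\succeq 0,\qquad X(k)Y(k)=P(k),\qquad k=0,\dots,T-1,$$ $$\eta I_n\preceq P(k)\preceq\rho I_n,\qquad k=0,\dots,T.$$ Then, with $$K(k)=U(k)Y(k)P(k)^{-1},\qquad k=0,\dots,T-1,$$ all trajectories of the closed-loop system $x(k+1)=\big(A(k)+B(k)K(k)\big)x(k)$ satisfy $$\|x(k)\|\le\sqrt{\frac{\rho}{\eta}}\left(1-\frac1\rho\right)^{k/2}\|x(0)\|,\qquad k=0,\dots,T.$$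
   Context: $\|\cdot\|$ is the Euclidean norm; $M\succeq 0$ means that the symmetric matrix $M$ is positive semidefinite. Data: for $j=1,\dots,L$, $u_{d,j}(k)\in\mathbb{R}^m$ ($k=0,\dots,T-1$) and $x_{d,j}(k)\in\mathbb{R}^n$ ($k=0,\dots,T$) are the input and state recorded in the $j$-th experiment. All $L$ experiments capture the same time-varying behaviour, i.e. $x_{d,j}(k+1)=A(k)x_{d,j}(k)+B(k)u_{d,j}(k)$ for all $j$ and $k=0,\dots,T-1$, with the same $A(k),B(k)$. The data matrices are $X(k)=[x_{d,1}(k),\dots,x_{d,L}(k)]$ and $U(k)=[u_{d,1}(k),\dots,u_{d,L}(k)]$; hence $X(k+1)=A(k)X(k)+B(k)U(k)$ for $k=0,\dots,T-1$. *)

theory Defs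
  imports "HOL-Analysis.Analysis"
begin

text \<open>Symmetry is part of the definition: the quadratic form alone does not imply it over the reals.\<close>

definition psd :: "real^'n^'n \<Rightarrow> bool" where
  "psd M \<longleftrightarrow> transpose M = M \<and> (\<forall>v. 0 \<le> v \<bullet> (M *v v))"

definition loewner_le :: "real^'n^'n \<Rightarrow> real^'n^'n \<Rightarrow> bool" where
  "loewner_le M N \<longleftrightarrow> psd (N - M)"

definition matrix_of_columns :: "('l \<Rightarrow> real^'n) \<Rightarrow> real^'l^'n" where
  "matrix_of_columns v = (\<chi> i j. v j $ i)"

text \<open>Block matrices are indexed by sum types: \<open>Inl\<close> is the first block, \<open>Inr\<close> the second.\<close>

definition stack_rows :: "real^'c^'a \<Rightarrow> real^'c^'b \<Rightarrow> real^'c^('a + 'b)" where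
  "stack_rows M N = (\<chi> i j. case i of Inl a \<Rightarrow> M $ a $ j | Inr b \<Rightarrow> N $ b $ j)"

definition block_matrix ::
  "real^'c^'a \<Rightarrow> real^'d^'a \<Rightarrow> real^'c^'b \<Rightarrow> real^'d^'b \<Rightarrow> real^('c + 'd)^('a + 'b)" where
  "block_matrix M11 M12 M21 M22 = (\<chi> i j.
     (case i of
        Inl a \<Rightarrow> (case j of Inl c \<Rightarrow> M11 $ a $ c | Inr d \<Rightarrow> M12 $ a $ d)
      | Inr b \<Rightarrow> (case j of Inl c \<Rightarrow> M21 $ b $ c | Inr d \<Rightarrow> M22 $ b $ d)))"

end

theory Submission
  imports Defs
begin

text \<open>
  The function \<open>V k = x k \<bullet> z k\<close> with \<open>z k = (P k)\<inverse> x k\<close> is a Lyapunov function. Written in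
  terms of \<open>z k\<close>, its decrease is what the linear matrix inequality (LMI) says at one well-chosen
  vector.

  Since \<open>X (k+1) = A k X k + B k U k\<close> and \<open>X k Y k = P k\<close>, the gain \<open>K k = U k Y k (P k)\<inverse>\<close> yields
  \<open>(A k + B k K k) P k = X (k+1) Y k\<close>: the off-diagonal block of the LMI is the closed-loop
  matrix times \<open>P k\<close>, and \<open>x (k+1) = X (k+1) Y k z k\<close> (lemma \<open>closed_loop_step_from_data\<close>).

  With \<open>c = 1 - 1/\<rho>\<close>, the quadratic form of the LMI at the pair \<open>(- z (k+1), c z k)\<close> equals
  \<open>V (k+1) - \<parallel>z (k+1)\<parallel>\<^sup>2 - 2 c V (k+1) + c\<^sup>2 V k\<close>.
  From \<open>P (k+1) \<le> \<rho> I\<close> one has \<open>V (k+1) \<le> \<rho> \<parallel>z (k+1)\<parallel>\<^sup>2\<close>, so this is at most \<open>c (c V k - V (k+1))\<close>;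
  as \<open>c > 0\<close>, it follows that \<open>V (k+1) \<le> c V k\<close> (lemma \<open>lyapunov_contraction\<close>). The bounds
  \<open>\<eta> I \<le> P k \<le> \<rho> I\<close> give \<open>\<parallel>x k\<parallel>\<^sup>2 / \<rho> \<le> V k \<le> \<parallel>x k\<parallel>\<^sup>2 / \<eta>\<close> (lemmas
  \<open>norm_le_inverse_form\<close> and \<open>inverse_form_le_norm\<close>), which turns the decay of \<open>V\<close> into the
  decay of the norm.
\<close>

section \<open>Quadratic forms, Loewner bounds and block matrices\<close>

lemma matrix_of_columns_vector_mult:
  "matrix_of_columns v *v w = (\<Sum>j\<in>UNIV. w $ j *\<^sub>R v j)"
  by (simp add: matrix_of_columns_def matrix_vector_mult_def vec_eq_iff mult.commute)

lemma scaleR_mat_one_vector_mult: "(a *\<^sub>R mat 1 :: real^'n^'n) *v v = a *\<^sub>R v"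
  by (simp add: scaleR_matrix_vector_assoc [symmetric])

lemma quadratic_form_lower:
  assumes "loewner_le (a *\<^sub>R mat 1) M"
  shows "a * (v \<bullet> v) \<le> v \<bullet> (M *v v)"
  using assms
  by (auto simp: loewner_le_def psd_def matrix_vector_mult_diff_rdistrib
      scaleR_mat_one_vector_mult inner_diff_right)

lemma quadratic_form_upper:
  assumes "loewner_le M (b *\<^sub>R mat 1)"
  shows "v \<bullet> (M *v v) \<le> b * (v \<bullet> v)"
  using assms
  by (auto simp: loewner_le_def psd_def matrix_vector_mult_diff_rdistrib
      scaleR_mat_one_vector_mult inner_diff_right)

lemma symmetric_inner_commute:
  fixes M :: "real^'n^'n"
  assumes "transpose M = M"
  shows "v \<bullet> (M *v w) = w \<bullet> (M *v v)"
  by (metis assms dot_lmul_matrix inner_commute transpose_matrix_vector)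

lemma sum_UNIV_sum_type:
  fixes f :: "'a::finite + 'b::finite \<Rightarrow> real"
  shows "(\<Sum>i\<in>UNIV. f i) = (\<Sum>a\<in>UNIV. f (Inl a)) + (\<Sum>b\<in>UNIV. f (Inr b))"
  by (simp add: UNIV_Plus_UNIV [symmetric] sum.Plus del: UNIV_Plus_UNIV)

lemma psd_block_matrix_quadratic_form:
  fixes M11 :: "real^'a^'a" and M12 :: "real^'b^'a" and M22 :: "real^'b^'b"
  assumes "psd (block_matrix M11 M12 (transpose M12) M22)"
  shows "0 \<le> p \<bullet> (M11 *v p) + 2 * (p \<bullet> (M12 *v q)) + q \<bullet> (M22 *v q)"
proof -
  define v :: "real^('a + 'b)"
    where "v = (\<chi> i. case i of Inl a \<Rightarrow> p $ a | Inr b \<Rightarrow> q $ b)"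
  have "v \<bullet> (block_matrix M11 M12 (transpose M12) M22 *v v) =
      p \<bullet> (M11 *v p) + p \<bullet> (M12 *v q) + q \<bullet> (transpose M12 *v p) + q \<bullet> (M22 *v q)"
    by (simp add: v_def block_matrix_def inner_vec_def matrix_vector_mult_def
        sum_UNIV_sum_type sum.distrib distrib_left)
  moreover have "q \<bullet> (transpose M12 *v p) = p \<bullet> (M12 *v q)"
    by (metis dot_lmul_matrix inner_commute transpose_matrix_vector)
  ultimately show ?thesis
    using assms unfolding psd_def by (metis add.assoc mult_2)
qed

lemma mult_matrix_inv_vector:
  fixes M :: "real^'n^'n"
  assumes "invertible M"
  shows "M *v (matrix_inv M *v v) = v"
proof -
  have "M ** matrix_inv M = mat 1"
    using assms unfolding invertible_def matrix_inv_def by (rule someI2_ex) blast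
  then show ?thesis
    by (simp add: matrix_vector_mul_assoc)
qed

lemma invertible_if_loewner_ge:
  assumes "loewner_le (a *\<^sub>R mat 1) M" and "a > 0"
  shows "invertible M"
proof -
  have "v = 0" if "M *v v = 0" for v
  proof -
    have "v \<bullet> v \<le> 0"
      using quadratic_form_lower [OF assms(1), of v] that \<open>a > 0\<close>
      by (simp add: mult_le_0_iff)
    then show ?thesis
      by (metis inner_eq_zero_iff inner_ge_zero order_antisym)
  qed
  then show ?thesis
    by (simp add: invertible_left_inverse matrix_left_invertible_ker)
qed

section \<open>Comparing the inverse form with the norm\<close>

text \<open>
  Below, \<open>x = P z\<close>, so that \<open>x \<bullet> z\<close> is the value at \<open>x\<close> of the form of the inverse of \<open>P\<close>. An upper
  bound on \<open>P\<close> bounds this value from below, because the form of \<open>P\<close> is nonnegative at \<open>x - b z\<close>.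
\<close>

lemma norm_le_inverse_form:
  fixes P :: "real^'n^'n"
  assumes sym: "transpose P = P"
    and lower: "loewner_le (a *\<^sub>R mat 1) P" and "a \<ge> 0"
    and upper: "loewner_le P (b *\<^sub>R mat 1)" and "b > 0"
    and x: "x = P *v z"
  shows "x \<bullet> x \<le> b * (x \<bullet> z)"
proof -
  let ?w = "x - b *\<^sub>R z"
  have "0 \<le> ?w \<bullet> (P *v ?w)"
    using quadratic_form_lower [OF lower, of ?w] \<open>a \<ge> 0\<close>
    by (meson inner_ge_zero mult_nonneg_nonneg order_trans)
  also have "?w \<bullet> (P *v ?w) = x \<bullet> (P *v x) - 2 * b * (x \<bullet> x) + b * (b * (x \<bullet> z))"
    using symmetric_inner_commute [OF sym, of z x]
    by (simp add: x [symmetric] matrix_vector_mult_diff_distrib matrix_vector_mult_scaleR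
        inner_diff_left inner_diff_right inner_commute algebra_simps)
  also have "\<dots> \<le> b * (b * (x \<bullet> z) - x \<bullet> x)"
    using quadratic_form_upper [OF upper, of x] by (simp add: algebra_simps)
  finally show ?thesis
    using \<open>b > 0\<close> by (simp add: zero_le_mult_iff)
qed

text \<open>
  In the other direction, expand \<open>0 \<le> \<parallel>x - a z\<parallel>\<^sup>2\<close> and absorb the term \<open>a\<^sup>2 \<parallel>z\<parallel>\<^sup>2\<close> into \<open>a (x \<bullet> z)\<close>
  by the lower bound on \<open>P\<close>.
\<close>

lemma inverse_form_le_norm:
  fixes P :: "real^'n^'n"
  assumes lower: "loewner_le (a *\<^sub>R mat 1) P" and "a > 0"
    and x: "x = P *v z"
  shows "a * (x \<bullet> z) \<le> x \<bullet> x"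
proof -
  have "0 \<le> (x - a *\<^sub>R z) \<bullet> (x - a *\<^sub>R z)"
    by simp
  also have "\<dots> = x \<bullet> x - 2 * a * (x \<bullet> z) + a * (a * (z \<bullet> z))"
    by (simp add: inner_diff_left inner_diff_right inner_commute algebra_simps)
  finally have "0 \<le> x \<bullet> x - 2 * a * (x \<bullet> z) + a * (a * (z \<bullet> z))" .
  moreover have "a * (a * (z \<bullet> z)) \<le> a * (x \<bullet> z)"
    using quadratic_form_lower [OF lower, of z] \<open>a > 0\<close>
    by (intro mult_left_mono) (simp_all add: x inner_commute)
  ultimately show ?thesis
    by (simp add: algebra_simps)
qed

section \<open>One step of the closed loop\<close>

text \<open>
  Any combination \<open>Y z\<close> of the recorded experiments is again a transition of the system, by
  linearity. The one with \<open>X Y z = x\<close> has the input \<open>U Y z = K x\<close> of the feedback law, so it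
  predicts the closed-loop successor without reference to \<open>A\<close> and \<open>B\<close>.
\<close>

lemma closed_loop_step_from_data:
  fixes A :: "real^'n^'n" and B :: "real^'m^'n" and Y :: "real^'n^'l::finite"
  assumes data: "\<And>j. xnext j = A *v xcur j + B *v ucur j"
    and XY: "matrix_of_columns xcur ** Y = P"
    and inv: "invertible P"
  shows "(A + B ** (matrix_of_columns ucur ** Y ** matrix_inv P)) *v x =
    matrix_of_columns xnext ** Y *v (matrix_inv P *v x)"
proof -
  let ?z = "matrix_inv P *v x"
  have x: "P *v ?z = x"
    by (rule mult_matrix_inv_vector [OF inv])
  have columns: "matrix_of_columns xnext *v w =
      A *v (matrix_of_columns xcur *v w) + B *v (matrix_of_columns ucur *v w)" for w
    by (simp add: matrix_of_columns_vector_mult data linear_sum linear_cmul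
        matrix_vector_mul_linear scaleR_add_right sum.distrib)
  have "matrix_of_columns xnext ** Y *v ?z =
      A *v (P *v ?z) + B *v (matrix_of_columns ucur *v (Y *v ?z))"
    using columns [of "Y *v ?z"] XY by (metis matrix_vector_mul_assoc)
  also have "\<dots> = (A + B ** (matrix_of_columns ucur ** Y ** matrix_inv P)) *v x"
    by (simp add: x matrix_vector_mult_add_rdistrib matrix_vector_mul_assoc [symmetric])
  finally show ?thesis ..
qed

text \<open>
  For the test pair \<open>(- z', s z)\<close> the LMI is a quadratic inequality in \<open>s\<close>. Its sharpest instance is
  \<open>s = V' / V\<close> with \<open>V = x \<bullet> z\<close> and \<open>V' = x' \<bullet> z'\<close>; taking \<open>s\<close> equal to the claimed rate
  \<open>1 - 1/\<rho>\<close> gives the same conclusion and also covers \<open>V = 0\<close>. In contrast, \<open>s = 1\<close> would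
  only yield the weaker rate \<open>1 / (1 + 1/\<rho>)\<close>.
\<close>

lemma lyapunov_contraction:
  fixes P P' M :: "real^'n^'n"
  assumes lmi: "psd (block_matrix (P' - mat 1) M (transpose M) P)"
    and upper: "loewner_le P' (\<rho> *\<^sub>R mat 1)" and "\<rho> > 1"
    and x: "x = P *v z" and x': "x' = P' *v z'" and step: "x' = M *v z"
  shows "x' \<bullet> z' \<le> (1 - 1 / \<rho>) * (x \<bullet> z)"
proof -
  define c where "c = 1 - 1 / \<rho>"
  define V where "V = x \<bullet> z"
  define V' where "V' = x' \<bullet> z'"
  have "c > 0"
    using \<open>\<rho> > 1\<close> by (simp add: c_def)
  have "V' \<le> \<rho> * (z' \<bullet> z')"
    using quadratic_form_upper [OF upper, of z'] by (simp add: V'_def x' inner_commute)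
  then have norm_z': "V' / \<rho> \<le> z' \<bullet> z'"
    using \<open>\<rho> > 1\<close> by (simp add: field_simps)
  have "0 \<le> V' - z' \<bullet> z' - 2 * c * V' + c * c * V"
    using psd_block_matrix_quadratic_form [OF lmi, of "- z'" "c *\<^sub>R z"]
    by (simp add: V_def V'_def matrix_vector_mult_diff_rdistrib matrix_vector_mult_scaleR
        linear_neg matrix_vector_mul_linear x [symmetric] x' [symmetric] step [symmetric]
        inner_diff_right inner_commute mult.assoc)
  also have "\<dots> \<le> V' - V' / \<rho> - 2 * c * V' + c * c * V"
    using norm_z' by simp
  also have "\<dots> = c * (c * V - V')"
    by (simp add: c_def algebra_simps)
  finally show ?thesis
    using \<open>c > 0\<close> by (simp add: zero_le_mult_iff c_def V_def V'_def)
qed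

section \<open>Exponential decay of the closed loop\<close>

theorem theorem1:
  fixes A :: "nat \<Rightarrow> real^'n^'n"
    and B :: "nat \<Rightarrow> real^'m^'n"
    and T :: nat
    and xd :: "'l::finite \<Rightarrow> nat \<Rightarrow> real^'n"
    and ud :: "'l \<Rightarrow> nat \<Rightarrow> real^'m"
    and X :: "nat \<Rightarrow> real^'l^'n"
    and U :: "nat \<Rightarrow> real^'l^'m"
    and \<eta> \<rho> :: real
    and Y :: "nat \<Rightarrow> real^'n^'l"
    and P :: "nat \<Rightarrow> real^'n^'n"
    and K :: "nat \<Rightarrow> real^'n^'m"
    and x :: "nat \<Rightarrow> real^'n"
  assumes data: "\<And>j k. k < T \<Longrightarrow> xd j (k + 1) = A k *v xd j k + B k *v ud j k"
    and X_def: "\<And>k. k \<le> T \<Longrightarrow> X k = matrix_of_columns (\<lambda>j. xd j k)"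
    and U_def: "\<And>k. k < T \<Longrightarrow> U k = matrix_of_columns (\<lambda>j. ud j k)"
    and rank_cond: "\<And>k. k < T \<Longrightarrow> rank (stack_rows (X k) (U k)) = CARD('n) + CARD('m)"
    and eta: "\<eta> \<ge> 1"
    and rho: "\<rho> > \<eta>"
    and P_sym: "\<And>k. k \<le> T \<Longrightarrow> P k = transpose (P k)"
    and lmi: "\<And>k. k < T \<Longrightarrow>
      psd (block_matrix (P (k + 1) - mat 1) (X (k + 1) ** Y k)
                        (transpose (Y k) ** transpose (X (k + 1))) (P k))"
    and XY: "\<And>k. k < T \<Longrightarrow> X k ** Y k = P k"
    and P_lower: "\<And>k. k \<le> T \<Longrightarrow> loewner_le (\<eta> *\<^sub>R mat 1) (P k)"
    and P_upper: "\<And>k. k \<le> T \<Longrightarrow> loewner_le (P k) (\<rho> *\<^sub>R mat 1)"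
    and K_def: "\<And>k. k < T \<Longrightarrow> K k = U k ** Y k ** matrix_inv (P k)"
    and closed_loop: "\<And>k. k < T \<Longrightarrow> x (k + 1) = (A k + B k ** K k) *v x k"
  shows "\<forall>k\<le>T. norm (x k) \<le> sqrt (\<rho> / \<eta>) * (1 - 1 / \<rho>) powr (real k / 2) * norm (x 0)"
proof (intro allI impI)
  fix k
  assume "k \<le> T"
  define z where "z i = matrix_inv (P i) *v x i" for i
  define V where "V i = x i \<bullet> z i" for i
  define c where "c = 1 - 1 / \<rho>"
  have pos: "\<eta> > 0" "\<rho> > 1" "c > 0"
    using eta rho by (auto simp: c_def)
  have inv: "invertible (P i)" if "i \<le> T" for i
    using invertible_if_loewner_ge [OF P_lower [OF that]] pos by simp
  have x: "x i = P i *v z i" if "i \<le> T" for i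
    by (simp add: z_def mult_matrix_inv_vector inv that)
  have step: "x (i + 1) = X (i + 1) ** Y i *v z i" if "i < T" for i
  proof -
    have Xi: "X i = matrix_of_columns (\<lambda>j. xd j i)"
      and Xnext: "X (i + 1) = matrix_of_columns (\<lambda>j. xd j (i + 1))"
      using X_def that by simp_all
    have "(A i + B i ** K i) *v x i = X (i + 1) ** Y i *v (matrix_inv (P i) *v x i)"
      unfolding Xnext K_def [OF that] U_def [OF that]
    proof (rule closed_loop_step_from_data)
      show "matrix_of_columns (\<lambda>j. xd j i) ** Y i = P i"
        using XY [OF that] Xi by simp
    qed (use that data inv in auto)
    then show ?thesis
      using closed_loop [OF that] by (simp add: z_def)
  qed
  have contraction: "V (i + 1) \<le> c * V i" if "i < T" for i
    unfolding V_def c_def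
  proof (rule lyapunov_contraction)
    show "psd (block_matrix (P (i + 1) - mat 1) (X (i + 1) ** Y i)
        (transpose (X (i + 1) ** Y i)) (P i))"
      using lmi [OF that] by (simp add: matrix_transpose_mul)
    show "loewner_le (P (i + 1)) (\<rho> *\<^sub>R mat 1)"
      using P_upper that by simp
  qed (use that pos x step in auto)
  have decay: "V i \<le> c ^ i * V 0" if "i \<le> T" for i
    using that
  proof (induction i)
    case (Suc i)
    then have "V (Suc i) \<le> c * V i"
      using contraction [of i] by simp
    also have "\<dots> \<le> c * (c ^ i * V 0)"
      using Suc pos by (intro mult_left_mono) auto
    finally show ?case
      by simp
  qed simp
  have "x k \<bullet> x k \<le> \<rho> * V k"
    unfolding V_def using norm_le_inverse_form [OF P_sym [symmetric] P_lower _ P_upper] \<open>k \<le> T\<close> pos x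
    by simp
  also have "\<dots> \<le> \<rho> * (c ^ k * V 0)"
    using decay [OF \<open>k \<le> T\<close>] pos by simp
  also have "\<dots> \<le> \<rho> * (c ^ k * ((x 0 \<bullet> x 0) / \<eta>))"
  proof -
    have "V 0 \<le> (x 0 \<bullet> x 0) / \<eta>"
      using inverse_form_le_norm [OF P_lower pos(1) x, of 0] pos
      by (simp add: V_def field_simps)
    then show ?thesis
      using pos by (intro mult_left_mono) auto
  qed
  finally have "(norm (x k))\<^sup>2 \<le> \<rho> / \<eta> * c ^ k * (norm (x 0))\<^sup>2"
    by (simp add: power2_norm_eq_inner)
  then have "norm (x k) \<le> sqrt (\<rho> / \<eta> * c ^ k * (norm (x 0))\<^sup>2)"
    by (rule real_le_rsqrt)
  also have "\<dots> = sqrt (\<rho> / \<eta>) * sqrt (c ^ k) * norm (x 0)"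
    by (simp only: real_sqrt_mult real_sqrt_abs abs_norm_cancel)
  also have "sqrt (c ^ k) = c powr (real k / 2)"
    using pos by (simp add: powr_half_sqrt [symmetric] powr_realpow [symmetric] powr_powr)
  finally show "norm (x k) \<le> sqrt (\<rho> / \<eta>) * (1 - 1 / \<rho>) powr (real k / 2) * norm (x 0)"
    by (simp add: c_def)
qed

end
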